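(* Let $T>0$ and $x\in\mathbb{R}^d$, and consider the SDE $$dX_t=b(t,X_t)\,dt+\sigma(t,X_t)\,dW_t,\qquad X_0=x,\quad t\in[0,T],$$ where $b:[0,T]\times\mathbb{R}^d\to\mathbb{R}^d$ and $\sigma:[0,T]\times\mathbb{R}^d\to\mathcal{M}(d\times q)$ are continuous. Assume that on every filtered probability space $(\Omega,\mathcal{A},(\mathcal{F}_t)_{t\in[0,T]},\mathbb{P})$ on which there exists a standard ($q$-dimensional) $\mathcal{F}_t$-Brownian motion $W$, the SDE has a strong solution on $[0,T]$, and that its Euler scheme with step $T/n$ (built from the increments of $W$) converges to it, as $n\to\infty$, in every $L^p(\mathbb{P})$, $p\in[1,\infty)$, for the sup-norm over $[0,T]$. Assume furthermore that the SDE admits the expansion $(\mathcal{E}^V_R)$ of the context at an order $R\ge1$ for a characterizing vector space $V$ of continuous functions $f:\mathbb{R}^d\to\mathbb{R}$ with polynomial growth, stable by product. Let $\alpha\in\mathbb{R}^R$ be defined by $\alpha_r=(-1)^{R-r}\frac{r^R}{r!(R-r)!}$, $1\le r\le R$. For every $r\in\{1,\dots,R\}$ set $$U^{(r)}_k:=\sqrt{\tfrac{rn}{T}}\Big(W_{\frac{kT}{rn}}-W_{\frac{(k-1)T}{rn}}\Big),\qquad 1\le k\le rn,$$ with the same Brownian motion $W$ for all $r$, and let $\bar X^{(r)}$ be the Euler scheme of the SDE with step $\frac{T}{rn}$ associated with the Gaussian white noise $(U^{(r)}_k)_k$. Then, for every $f\in V$, as $n\to\infty$, $$\mathbb{E}\Big(\sum_{r=1}^R\alpha_r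 f(\bar X^{(r)}_T)\Big)=\mathbb{E}(f(X_T))+O(n^{-R})\quad\text{and}\quad \lim_{n}\mathrm{Var}\Big(\sum_{r=1}^R\alpha_r f(\bar X^{(r)}_T)\Big)=\mathrm{Var}(f(X_T)).$$
   Context: Euler scheme: the Euler scheme $\bar X$ with step $T/m$ associated with the white noise $(U_k)_{1\le k\le m}$ is defined by $\bar X_0=x$ and, with $t_k=kT/m$, $$\bar X_{t_{k+1}}=\bar X_{t_k}+b(t_k,\bar X_{t_k})\tfrac{T}{m}+\sigma(t_k,\bar X_{t_k})\sqrt{\tfrac{T}{m}}\,U_{k+1},\quad k=0,\dots,m-1,$$ and it is extended to all times by $\bar X_t=\bar X_{t_k}$ for $t\in[t_k,t_{k+1})$ (stepwise constant). It is "built from the increments of $W$" when $U_k=\sqrt{m/T}\,(W_{t_k}-W_{t_{k-1}})$. Convergence in $L^p$ for the sup-norm means $\mathbb{E}\big[\sup_{t\in[0,T]}|X_t-\bar X_t|^p\big]\to0$ as the number of steps goes to infinity. Expansion $(\mathcal{E}^V_R)$: for every $f\in V$ there are real constants $c_1,\dots,c_{R-1}$, not depending on $n$, such that $$\mathbb{E}(f(X_T))=\mathbb{E}(f(\bar X_T))+\sum_{k=1}^{R-1}\frac{c_k}{n^k}+O(n^{-R}),$$ where $\bar X$ is the Euler scheme with step $T/n$ built from the increments of $W$. $V$ is characterizing: for every pair of $\mathbb{R}^d$-valued random vectors $Y,Z$ on a common probability space, if $f(Y)=f(Z)$ a.s. for every $f\in V$, then $Y=Z$ a.s. *)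

theory Defs
  imports "HOL-Probability.Probability" "HOL-Library.Landau_Symbols"
begin

section \<open>Brownian motion on a filtered probability space\<close>

definition filtration_on :: "real \<Rightarrow> 'w measure \<Rightarrow> (real \<Rightarrow> 'w measure) \<Rightarrow> bool" where
  "filtration_on T M F \<longleftrightarrow>
     (\<forall>t\<in>{0..T}. subalgebra M (F t)) \<and>
     (\<forall>s\<in>{0..T}. \<forall>t\<in>{0..T}. s \<le> t \<longrightarrow> sets (F s) \<subseteq> sets (F t))"

text \<open>Increments over \<open>[s, t]\<close> are independent of \<open>F s\<close> and have the law \<open>N(0, (t - s) I)\<close>, given by
  its joint density; \<open>normal_density\<close> takes the standard deviation.\<close>

definition brownian_motion_on ::
    "real \<Rightarrow> 'w measure \<Rightarrow> (real \<Rightarrow> 'w measure) \<Rightarrow> (real \<Rightarrow> 'w \<Rightarrow> real^'q) \<Rightarrow> bool" where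
  "brownian_motion_on T M F W \<longleftrightarrow>
     (\<forall>t\<in>{0..T}. W t \<in> borel_measurable (F t)) \<and>
     (\<forall>\<omega>\<in>space M. continuous_on {0..T} (\<lambda>t. W t \<omega>)) \<and>
     (AE \<omega> in M. W 0 \<omega> = 0) \<and>
     (\<forall>s\<in>{0..T}. \<forall>t\<in>{0..T}. s < t \<longrightarrow>
        prob_space.indep_set M (sets (F s))
          (sets (vimage_algebra (space M) (\<lambda>\<omega>. W t \<omega> - W s \<omega>) borel)) \<and>
        distributed M lborel (\<lambda>\<omega>. W t \<omega> - W s \<omega>)
          (\<lambda>y. \<Prod>i\<in>UNIV. normal_density 0 (sqrt (t - s)) (y $ i)))"

definition brownian_setup ::
    "real \<Rightarrow> 'w measure \<Rightarrow> (real \<Rightarrow> 'w measure) \<Rightarrow> (real \<Rightarrow> 'w \<Rightarrow> real^'q) \<Rightarrow> bool" where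
  "brownian_setup T M F W \<longleftrightarrow>
     prob_space M \<and> filtration_on T M F \<and> brownian_motion_on T M F W"

text \<open>The filtration generated by \<open>W\<close>, augmented by the null sets of \<open>M\<close>.\<close>

definition augmented_filtration ::
    "'w measure \<Rightarrow> (real \<Rightarrow> 'w \<Rightarrow> real^'q) \<Rightarrow> real \<Rightarrow> 'w measure" where
  "augmented_filtration M W t =
     sigma (space M)
       ({W s -` A \<inter> space M | s A. s \<in> {0..t} \<and> A \<in> sets borel} \<union> null_sets M)"

section \<open>The Ito integral\<close>

text \<open>A simple integrand is \<open>\<Sum>i<m. \<xi> i * 1_{(u i, u (i+1)]}\<close> with bounded \<open>F (u i)\<close>-measurable
  matrix-valued \<open>\<xi> i\<close>.\<close>

definition simple_data ::
    "real \<Rightarrow> 'w measure \<Rightarrow> (real \<Rightarrow> 'w measure) \<Rightarrow> nat \<Rightarrow> (nat \<Rightarrow> real) \<Rightarrow>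
     (nat \<Rightarrow> 'w \<Rightarrow> real^'q^'d) \<Rightarrow> bool" where
  "simple_data T M F m u \<xi> \<longleftrightarrow>
     (\<forall>i\<le>m. u i \<in> {0..T}) \<and> (\<forall>i<m. u i \<le> u (Suc i)) \<and>
     (\<forall>i<m. \<xi> i \<in> borel_measurable (F (u i)) \<and> bounded (\<xi> i ` space M))"

definition simple_process ::
    "nat \<Rightarrow> (nat \<Rightarrow> real) \<Rightarrow> (nat \<Rightarrow> 'w \<Rightarrow> real^'q^'d) \<Rightarrow> real \<Rightarrow> 'w \<Rightarrow> real^'q^'d" where
  "simple_process m u \<xi> t \<omega> = (\<Sum>i<m. indicator {u i<..u (Suc i)} t *\<^sub>R \<xi> i \<omega>)"

definition simple_integral ::
    "(real \<Rightarrow> 'w \<Rightarrow> real^'q) \<Rightarrow> nat \<Rightarrow> (nat \<Rightarrow> real) \<Rightarrow> (nat \<Rightarrow> 'w \<Rightarrow> real^'q^'d) \<Rightarrow>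
     real \<Rightarrow> 'w \<Rightarrow> real^'d" where
  "simple_integral W m u \<xi> t \<omega> =
     (\<Sum>i<m. \<xi> i \<omega> *v (W (min t (u (Suc i))) \<omega> - W (min t (u i)) \<omega>))"

definition progressively_measurable ::
    "real \<Rightarrow> (real \<Rightarrow> 'w measure) \<Rightarrow> (real \<Rightarrow> 'w \<Rightarrow> 'v::topological_space) \<Rightarrow> bool" where
  "progressively_measurable T F H \<longleftrightarrow>
     (\<forall>t\<in>{0..T}. (\<lambda>(s, \<omega>). H s \<omega>) \<in>
        borel_measurable (restrict_space borel {0..t} \<Otimes>\<^sub>M F t))"

text \<open>\<open>I\<close> is (a version of) the continuous process \<open>\<integral>H dW\<close> on \<open>[0,T]\<close>, for \<open>H\<close> progressive with
  \<open>\<integral>|H|\<^sup>2 < \<infinity>\<close> a.s.: the limit of integrals of simple integrands \<open>H\<^sub>n\<close> with \<open>\<integral>|H\<^sub>n - H|\<^sup>2 \<rightarrow> 0\<close> in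
  probability, uniformly in time in probability. The norm on matrices is the Frobenius norm. All events
  below are measurable, by progressive measurability of \<open>H\<close> and continuity of the paths of \<open>I\<close> and \<open>W\<close>.\<close>

definition has_ito_integral ::
    "real \<Rightarrow> 'w measure \<Rightarrow> (real \<Rightarrow> 'w measure) \<Rightarrow> (real \<Rightarrow> 'w \<Rightarrow> real^'q) \<Rightarrow>
     (real \<Rightarrow> 'w \<Rightarrow> real^'q^'d) \<Rightarrow> (real \<Rightarrow> 'w \<Rightarrow> real^'d) \<Rightarrow> bool" where
  "has_ito_integral T M F W H I \<longleftrightarrow>
     progressively_measurable T F H \<and>
     (AE \<omega> in M. (\<integral>\<^sup>+t\<in>{0..T}. ennreal ((norm (H t \<omega>))\<^sup>2) \<partial>lborel) < \<infinity>) \<and>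
     (\<forall>t\<in>{0..T}. I t \<in> borel_measurable (F t)) \<and>
     (\<forall>\<omega>\<in>space M. continuous_on {0..T} (\<lambda>t. I t \<omega>)) \<and>
     (\<exists>m u \<xi>.
        (\<forall>n. simple_data T M F (m n) (u n) (\<xi> n)) \<and>
        (\<forall>\<epsilon>>0. (\<lambda>n. measure M {\<omega>\<in>space M. ennreal \<epsilon> <
             (\<integral>\<^sup>+t\<in>{0..T}. ennreal ((norm (simple_process (m n) (u n) (\<xi> n) t \<omega> - H t \<omega>))\<^sup>2) \<partial>lborel)})
           \<longlonglongrightarrow> 0) \<and>
        (\<forall>\<epsilon>>0. (\<lambda>n. measure M {\<omega>\<in>space M. \<exists>t\<in>{0..T}.
             \<epsilon> < norm (simple_integral W (m n) (u n) (\<xi> n) t \<omega> - I t \<omega>)})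
           \<longlonglongrightarrow> 0))"

section \<open>Strong solutions and the Euler scheme\<close>

text \<open>As usual for strong solutions, \<open>X\<close> is adapted to the augmented filtration of the driving \<open>W\<close>.\<close>

definition strong_solution ::
    "real \<Rightarrow> real^'d \<Rightarrow> (real \<Rightarrow> real^'d \<Rightarrow> real^'d) \<Rightarrow> (real \<Rightarrow> real^'d \<Rightarrow> real^'q^'d) \<Rightarrow>
     'w measure \<Rightarrow> (real \<Rightarrow> 'w \<Rightarrow> real^'q) \<Rightarrow> (real \<Rightarrow> 'w \<Rightarrow> real^'d) \<Rightarrow> bool" where
  "strong_solution T x b \<sigma> M W X \<longleftrightarrow>
     (\<forall>t\<in>{0..T}. X t \<in> borel_measurable (augmented_filtration M W t)) \<and>
     (\<forall>\<omega>\<in>space M. continuous_on {0..T} (\<lambda>t. X t \<omega>)) \<and>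
     (AE \<omega> in M. X 0 \<omega> = x) \<and>
     (\<exists>I. has_ito_integral T M (augmented_filtration M W) W (\<lambda>t \<omega>. \<sigma> t (X t \<omega>)) I \<and>
        (AE \<omega> in M. \<forall>t\<in>{0..T}. X t \<omega> = x + integral {0..t} (\<lambda>s. b s (X s \<omega>)) + I t \<omega>))"

text \<open>\<open>euler T x b \<sigma> m U k\<close> is the value at \<open>t\<^sub>k = k T / m\<close> of the scheme with step \<open>T / m\<close> driven by
  \<open>U 1, \<dots>, U m\<close>. The floor in \<open>euler_path\<close> is the \<open>k\<close> with \<open>t \<in> [t\<^sub>k, t\<^sub>k\<^sub>+\<^sub>1)\<close>.\<close>

primrec euler ::
    "real \<Rightarrow> real^'d \<Rightarrow> (real \<Rightarrow> real^'d \<Rightarrow> real^'d) \<Rightarrow> (real \<Rightarrow> real^'d \<Rightarrow> real^'q^'d) \<Rightarrow>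
     nat \<Rightarrow> (nat \<Rightarrow> real^'q) \<Rightarrow> nat \<Rightarrow> real^'d" where
  "euler T x b \<sigma> m U 0 = x"
| "euler T x b \<sigma> m U (Suc k) =
     euler T x b \<sigma> m U k
     + (T / real m) *\<^sub>R b (real k * T / real m) (euler T x b \<sigma> m U k)
     + sqrt (T / real m) *\<^sub>R (\<sigma> (real k * T / real m) (euler T x b \<sigma> m U k) *v U (Suc k))"

definition euler_path ::
    "real \<Rightarrow> real^'d \<Rightarrow> (real \<Rightarrow> real^'d \<Rightarrow> real^'d) \<Rightarrow> (real \<Rightarrow> real^'d \<Rightarrow> real^'q^'d) \<Rightarrow>
     nat \<Rightarrow> (nat \<Rightarrow> real^'q) \<Rightarrow> real \<Rightarrow> real^'d" where
  "euler_path T x b \<sigma> m U t = euler T x b \<sigma> m U (nat \<lfloor>t * real m / T\<rfloor>)"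

definition brownian_noise ::
    "real \<Rightarrow> nat \<Rightarrow> (real \<Rightarrow> 'w \<Rightarrow> real^'q) \<Rightarrow> 'w \<Rightarrow> nat \<Rightarrow> real^'q" where
  "brownian_noise T m W \<omega> k =
     sqrt (real m / T) *\<^sub>R (W (real k * T / real m) \<omega> - W ((real k - 1) * T / real m) \<omega>)"

definition brownian_euler ::
    "real \<Rightarrow> real^'d \<Rightarrow> (real \<Rightarrow> real^'d \<Rightarrow> real^'d) \<Rightarrow> (real \<Rightarrow> real^'d \<Rightarrow> real^'q^'d) \<Rightarrow>
     (real \<Rightarrow> 'w \<Rightarrow> real^'q) \<Rightarrow> nat \<Rightarrow> real \<Rightarrow> 'w \<Rightarrow> real^'d" where
  "brownian_euler T x b \<sigma> W m t \<omega> = euler_path T x b \<sigma> m (brownian_noise T m W \<omega>) t"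

definition converges_in_Lp_sup ::
    "real \<Rightarrow> 'w measure \<Rightarrow> real \<Rightarrow> (nat \<Rightarrow> real \<Rightarrow> 'w \<Rightarrow> real^'d) \<Rightarrow> (real \<Rightarrow> 'w \<Rightarrow> real^'d) \<Rightarrow> bool"
where
  "converges_in_Lp_sup T M p Y X \<longleftrightarrow>
     (\<lambda>n. \<integral>\<^sup>+\<omega>. (SUP t\<in>{0..T}. ennreal (norm (X t \<omega> - Y n t \<omega>) powr p)) \<partial>M) \<longlonglongrightarrow> 0"

section \<open>The class of test functions and the expansion\<close>

definition polynomial_growth :: "(real^'d \<Rightarrow> real) \<Rightarrow> bool" where
  "polynomial_growth f \<longleftrightarrow> (\<exists>C (k::nat). \<forall>y. \<bar>f y\<bar> \<le> C * (1 + norm y ^ k))"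

definition function_space :: "('v \<Rightarrow> real) set \<Rightarrow> bool" where
  "function_space V \<longleftrightarrow>
     (\<lambda>_. 0) \<in> V \<and> (\<forall>f\<in>V. \<forall>g\<in>V. (\<lambda>y. f y + g y) \<in> V) \<and> (\<forall>c. \<forall>f\<in>V. (\<lambda>y. c * f y) \<in> V)"

definition product_stable :: "('v \<Rightarrow> real) set \<Rightarrow> bool" where
  "product_stable V \<longleftrightarrow> (\<forall>f\<in>V. \<forall>g\<in>V. (\<lambda>y. f y * g y) \<in> V)"

text \<open>HOL cannot quantify over the type of the sample space. Taking the type of pairs of vectors loses
  nothing, since only the joint law of \<open>(Y, Z)\<close> matters: see \<open>characterizingD\<close>.\<close>

definition characterizing :: "(real^'d \<Rightarrow> real) set \<Rightarrow> bool" where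
  "characterizing V \<longleftrightarrow>
     (\<forall>(M :: ((real^'d) \<times> (real^'d)) measure) Y Z.
        prob_space M \<longrightarrow> Y \<in> borel_measurable M \<longrightarrow> Z \<in> borel_measurable M \<longrightarrow>
        (\<forall>f\<in>V. AE \<omega> in M. f (Y \<omega>) = f (Z \<omega>)) \<longrightarrow> (AE \<omega> in M. Y \<omega> = Z \<omega>))"

lemma characterizingD:
  fixes M :: "'w measure" and V :: "(real^'d \<Rightarrow> real) set"
  assumes V: "characterizing V" "V \<subseteq> borel_measurable borel"
    and M: "prob_space M" and Y: "Y \<in> borel_measurable M" and Z: "Z \<in> borel_measurable M"
    and eq: "\<And>f. f \<in> V \<Longrightarrow> AE \<omega> in M. f (Y \<omega>) = f (Z \<omega>)"
  shows "AE \<omega> in M. Y \<omega> = Z \<omega>"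
proof -
  define N where "N = distr M (borel \<Otimes>\<^sub>M borel) (\<lambda>\<omega>. (Y \<omega>, Z \<omega>))"
  have YZ: "(\<lambda>\<omega>. (Y \<omega>, Z \<omega>)) \<in> M \<rightarrow>\<^sub>M borel \<Otimes>\<^sub>M borel"
    using Y Z by measurable
  have N: "prob_space N"
    unfolding N_def using YZ by (rule prob_space.prob_space_distr[OF M])
  have fst_m: "fst \<in> borel_measurable N" and snd_m: "snd \<in> borel_measurable N"
    unfolding N_def by simp_all
  have "AE z in N. f (fst z) = f (snd z)" if f: "f \<in> V" for f
  proof -
    have [measurable]: "f \<in> borel_measurable borel" using V(2) f by auto
    have "{z \<in> space (borel \<Otimes>\<^sub>M borel). f (fst z) = f (snd z)} \<in> sets (borel \<Otimes>\<^sub>M borel)"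
      by measurable
    then show ?thesis
      unfolding N_def by (subst AE_distr_iff[OF YZ]) (use eq[OF f] in auto)
  qed
  then have ae: "AE z in N. fst z = snd z"
    using N fst_m snd_m by (intro V(1)[unfolded characterizing_def, rule_format, of N fst snd])
  have "{z \<in> space (borel \<Otimes>\<^sub>M borel :: ((real^'d) \<times> (real^'d)) measure). fst z = snd z}
      \<in> sets (borel \<Otimes>\<^sub>M borel)"
    by measurable
  from AE_distr_iff[OF YZ this] ae show ?thesis
    unfolding N_def by simp
qed

definition euler_expansion ::
    "real \<Rightarrow> real^'d \<Rightarrow> (real \<Rightarrow> real^'d \<Rightarrow> real^'d) \<Rightarrow> (real \<Rightarrow> real^'d \<Rightarrow> real^'q^'d) \<Rightarrow>
     'w measure \<Rightarrow> (real \<Rightarrow> 'w \<Rightarrow> real^'q) \<Rightarrow> (real \<Rightarrow> 'w \<Rightarrow> real^'d) \<Rightarrow>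
     nat \<Rightarrow> (real^'d \<Rightarrow> real) set \<Rightarrow> bool" where
  "euler_expansion T x b \<sigma> M W X R V \<longleftrightarrow>
     (\<forall>f\<in>V. \<exists>c :: nat \<Rightarrow> real.
        (\<lambda>n. prob_space.expectation M (\<lambda>\<omega>. f (X T \<omega>))
           - (prob_space.expectation M (\<lambda>\<omega>. f (brownian_euler T x b \<sigma> W n T \<omega>))
              + (\<Sum>k\<in>{1..<R}. c k / real n ^ k)))
        \<in> O(\<lambda>n. 1 / real n ^ R))"

definition richardson_weight :: "nat \<Rightarrow> nat \<Rightarrow> real" where
  "richardson_weight R r = (-1) ^ (R - r) * real r ^ R / (fact r * fact (R - r))"

definition multistep_estimator ::
    "real \<Rightarrow> real^'d \<Rightarrow> (real \<Rightarrow> real^'d \<Rightarrow> real^'d) \<Rightarrow> (real \<Rightarrow> real^'d \<Rightarrow> real^'q^'d) \<Rightarrow>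
     (real \<Rightarrow> 'w \<Rightarrow> real^'q) \<Rightarrow> nat \<Rightarrow> (real^'d \<Rightarrow> real) \<Rightarrow> nat \<Rightarrow> 'w \<Rightarrow> real" where
  "multistep_estimator T x b \<sigma> W R f n \<omega> =
     (\<Sum>r = 1..R. richardson_weight R r * f (brownian_euler T x b \<sigma> W (r * n) T \<omega>))"

end

theory Submission
  imports Defs
begin

text \<open>
  Both claims reduce to convergence of \<open>f (Y n)\<close> to \<open>f (X T)\<close> in \<open>L\<^sup>2\<close>, where \<open>Y n\<close> is the terminal value
  of the Euler scheme with \<open>n\<close> steps, together with an algebraic identity for the weights
  \<open>\<alpha> r = richardson_weight R r\<close>.

  The weights satisfy \<open>\<Sum>r. \<alpha> r = 1\<close> and \<open>\<Sum>r. \<alpha> r / r ^ k = 0\<close> for \<open>1 \<le> k < R\<close>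
  (\<open>richardson_weight_moment\<close>), because these sums are the \<open>R\<close>-th finite difference, divided by \<open>R!\<close>,
  of the monomials \<open>r ^ (R - k)\<close>. Substituting \<open>r * n\<close> for \<open>n\<close> in the expansion and
  averaging with the weights therefore keeps the limit and cancels every term of order below \<open>R\<close>
  (\<open>euler_expansion_refined\<close>).

  For the variance, all \<open>R\<close> schemes are driven by the same Brownian motion, so each \<open>f (Y (r * n))\<close>
  converges in \<open>L\<^sup>2\<close> to the same limit \<open>f (X T)\<close>. As the weights add up to one, so does
  the estimator (\<open>L2_tendsto_weighted_sum\<close>), and convergence in \<open>L\<^sup>2\<close> carries variances along
  (\<open>L2_tendsto_moments\<close>). The \<open>L\<^sup>2\<close> convergence itself follows from the \<open>L\<^sup>p\<close> convergence of \<open>Y n\<close> by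
  dominated convergence along subsequences (\<open>L2_tendsto_polynomial_growth\<close>), provided that \<open>X T\<close> has
  moments of all orders.

  That proviso is the delicate point: continuity of the coefficients gives no growth bound, and
  the terminal value of an individual Euler scheme may fail to be integrable. It is the sup-norm that rescues the argument
  (\<open>strong_solution_moment\<close>). Choose \<open>n\<close> such that the sup-distance between \<open>X\<close> and its Euler scheme is
  in \<open>L\<^sup>p\<close>. Moments then propagate along the grid: if \<open>X\<close> has a \<open>p\<close>-th moment at a grid point, so has
  the scheme; the scheme is constant until the next grid point, and by left-continuity of the path
  \<open>X\<close> at that next point is still within the sup-distance of this constant. The schemes are thus
  integrable for all large \<open>n\<close>, which suffices for asymptotic statements.
\<close>

section \<open>Cancellation by the Richardson weights\<close>

text \<open>The left-hand side is the \<open>R\<close>-th forward difference with unit step of \<open>t \<mapsto> t ^ j\<close> at \<open>x\<close>, divided by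
  \<open>R!\<close>. The free base point \<open>x\<close> makes the induction work: writing one factor \<open>x + r\<close> as a
  sum, the weight absorbs the factor \<open>r\<close>, which lowers \<open>R\<close> and shifts the base point to \<open>x + 1\<close>.\<close>

lemma binomial_difference_power:
  fixes x :: real
  assumes "j \<le> R"
  shows "(\<Sum>r\<le>R. (-1) ^ (R - r) / (fact r * fact (R - r)) * (x + real r) ^ j) = (if j = R then 1 else 0)"
  using assms
proof (induction j arbitrary: R x)
  case 0
  show ?case
  proof (cases "R = 0")
    case False
    have "(\<Sum>r\<le>R. (-1) ^ (R - r) / (fact r * fact (R - r)) :: real)
        = (-1) ^ R / fact R * (\<Sum>r\<le>R. (-1) ^ r * of_nat (R choose r))"
      unfolding sum_distrib_left
    proof (rule sum.cong)
      fix r assume "r \<in> {..R}"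
      then have "r \<le> R" by simp
      moreover from this have "(-1) ^ (R - r) = ((-1) ^ R * (-1) ^ r :: real)"
        by (simp add: minus_one_power_iff)
      ultimately show "(-1) ^ (R - r) / (fact r * fact (R - r))
          = ((-1) ^ R / fact R * ((-1) ^ r * of_nat (R choose r)) :: real)"
        by (simp add: binomial_fact field_simps)
    qed simp
    also have "\<dots> = 0"
      using choose_alternating_sum[of R, where ?'a = real] False by simp
    finally show ?thesis using False by simp
  qed simp
next
  case (Suc j)
  then obtain S where R: "R = Suc S" and "j \<le> S" by (cases R) auto
  let ?v = "\<lambda>R r. (-1) ^ (R - r) / (fact r * fact (R - r)) :: real"
  have shift: "?v (Suc S) (Suc r) * real (Suc r) = ?v S r" for r
    by (simp add: field_simps del: of_nat_Suc)
  have "(\<Sum>r\<le>R. ?v R r * (x + real r) ^ Suc j)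
      = x * (\<Sum>r\<le>R. ?v R r * (x + real r) ^ j) + (\<Sum>r\<le>R. ?v R r * real r * (x + real r) ^ j)"
    by (simp add: sum_distrib_left sum.distrib[symmetric] algebra_simps)
  also have "(\<Sum>r\<le>R. ?v R r * real r * (x + real r) ^ j)
      = (\<Sum>r\<le>S. ?v S r * ((x + 1) + real r) ^ j)"
    unfolding R sum.atMost_Suc_shift shift by (simp add: add_ac)
  also have "x * (\<Sum>r\<le>R. ?v R r * (x + real r) ^ j) = 0"
    using Suc.IH[of R x] \<open>j \<le> S\<close> R by simp
  finally show ?case
    using Suc.IH[of S "x + 1"] \<open>j \<le> S\<close> R by simp
qed

lemma richardson_weight_moment:
  assumes "k < R"
  shows "(\<Sum>r = 1..R. richardson_weight R r / real r ^ k) = (if k = 0 then 1 else 0)"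
proof -
  have "(\<Sum>r = 1..R. richardson_weight R r / real r ^ k)
      = (\<Sum>r = 1..R. (-1) ^ (R - r) / (fact r * fact (R - r)) * (0 + real r) ^ (R - k))"
  proof (rule sum.cong)
    fix r assume "r \<in> {1..R}"
    then have "real r ^ R = real r ^ (R - k) * real r ^ k" "real r ^ k \<noteq> 0"
      using assms by (simp_all flip: power_add)
    then show "richardson_weight R r / real r ^ k
        = (-1) ^ (R - r) / (fact r * fact (R - r)) * (0 + real r) ^ (R - k)"
      using assms by (simp add: richardson_weight_def)
  qed simp
  also have "\<dots> = (\<Sum>r\<le>R. (-1) ^ (R - r) / (fact r * fact (R - r)) * (0 + real r) ^ (R - k))"
    using assms by (intro sum.mono_neutral_left) (auto simp: not_le)
  finally show ?thesis
    using binomial_difference_power[of "R - k" R 0] assms by auto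
qed

section \<open>Convergence in mean square\<close>

lemma power_add_le:
  fixes a b :: real
  assumes "0 \<le> a" "0 \<le> b"
  shows "(a + b) ^ p \<le> 2 ^ p * (a ^ p + b ^ p)"
proof -
  have "(a + b) ^ p \<le> (2 * max a b) ^ p"
    using assms by (intro power_mono) auto
  also have "\<dots> \<le> 2 ^ p * (a ^ p + b ^ p)"
    using assms by (auto simp: power_mult_distrib max_def)
  finally show ?thesis .
qed

text \<open>The exponent can be taken positive, which is what is needed to recover convergence of the norm from
  convergence of its \<open>p\<close>-th power.\<close>

lemma polynomial_growth_square:
  assumes "polynomial_growth f"
  obtains A :: real and p :: nat
  where "0 < p" "0 \<le> A" "\<And>y. (f y)\<^sup>2 \<le> A * (1 + norm y ^ p)"
proof -
  from assms obtain C and k :: nat where f: "\<And>y. \<bar>f y\<bar> \<le> C * (1 + norm y ^ k)"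
    by (auto simp: polynomial_growth_def)
  have "(f y)\<^sup>2 \<le> 8 * C\<^sup>2 * (1 + norm y ^ ((k + 1) * 2))" for y
  proof -
    have "norm y ^ k \<le> 1 + norm y ^ (k + 1)"
    proof (cases "norm y \<le> 1")
      case True then show ?thesis
        using power_le_one[OF norm_ge_zero True, of k] zero_le_power[OF norm_ge_zero, of y "k + 1"]
        by linarith
    next
      case False then show ?thesis using power_increasing[of k "k + 1" "norm y"] by linarith
    qed
    then have le: "(1 + norm y ^ k) \<le> 2 + norm y ^ (k + 1)" by simp
    have sq_le: "(2 + z)\<^sup>2 \<le> 4 * (2 + z\<^sup>2)" for z :: real
    proof -
      have "4 * (2 + z\<^sup>2) - (2 + z)\<^sup>2 = (z - 2)\<^sup>2 + 2 * z\<^sup>2"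
        by (simp add: power2_eq_square algebra_simps)
      moreover have "0 \<le> (z - 2)\<^sup>2 + 2 * z\<^sup>2" by simp
      ultimately show ?thesis by linarith
    qed
    have "(f y)\<^sup>2 \<le> (C * (1 + norm y ^ k))\<^sup>2"
      using f[of y] by (metis abs_ge_zero order_trans power2_abs power_mono)
    also have "\<dots> \<le> C\<^sup>2 * (2 + norm y ^ (k + 1))\<^sup>2"
      unfolding power_mult_distrib using le by (intro mult_left_mono power_mono) auto
    also have "\<dots> \<le> C\<^sup>2 * (4 * (2 + (norm y ^ (k + 1))\<^sup>2))"
      using sq_le by (intro mult_left_mono) auto
    also have "(norm y ^ (k + 1))\<^sup>2 = norm y ^ ((k + 1) * 2)"
      by (rule power_mult[symmetric])
    finally have "(f y)\<^sup>2 \<le> C\<^sup>2 * (4 * (2 + norm y ^ ((k + 1) * 2)))" .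
    also have "\<dots> \<le> 8 * C\<^sup>2 * (1 + norm y ^ ((k + 1) * 2))"
      by (simp add: algebra_simps)
    finally show ?thesis .
  qed
  then show ?thesis by (intro that[of "(k + 1) * 2" "8 * C\<^sup>2"]) auto
qed

lemma tendsto_subsequenceI:
  fixes a :: "nat \<Rightarrow> 'a::topological_space"
  assumes "\<And>r. strict_mono r \<Longrightarrow> \<exists>s. strict_mono s \<and> (\<lambda>i. a (r (s i :: nat))) \<longlonglongrightarrow> l"
  shows "a \<longlonglongrightarrow> l"
proof (rule topological_tendstoI, rule ccontr)
  fix S assume S: "open S" "l \<in> S" "\<not> (\<forall>\<^sub>F n in sequentially. a n \<in> S)"
  from not_eventually_sequentiallyD[OF S(3)] obtain r :: "nat \<Rightarrow> nat"
    where r: "strict_mono r" "\<And>n. a (r n) \<notin> S" by auto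
  from assms[OF r(1)] obtain s :: "nat \<Rightarrow> nat" where "(\<lambda>i. a (r (s i))) \<longlonglongrightarrow> l" by auto
  from topological_tendstoD[OF this S(1,2)] r(2) show False by simp
qed

text \<open>The error \<open>(f (Y n) - f Z)\<^sup>2\<close> is at most \<open>K (1 + |Z| ^ p)\<close>, which is integrable, plus
  \<open>K |Y n - Z| ^ p\<close>, whose integral tends to zero. Its excess over the latter term is therefore
  dominated, and tends to zero almost everywhere along a subsequence of any subsequence.\<close>

lemma (in prob_space) L2_tendsto_polynomial_growth:
  fixes Y :: "nat \<Rightarrow> 'a \<Rightarrow> 'b::euclidean_space" and f :: "'b \<Rightarrow> real"
  assumes Y [measurable]: "\<And>n. Y n \<in> borel_measurable M" and Z [measurable]: "Z \<in> borel_measurable M"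
    and cont: "continuous_on UNIV f"
    and p: "0 < p" and A: "0 \<le> A" and growth: "\<And>y. (f y)\<^sup>2 \<le> A * (1 + norm y ^ p)"
    and fin: "(\<integral>\<^sup>+\<omega>. ennreal (norm (Z \<omega>) ^ p) \<partial>M) < \<infinity>"
    and conv: "(\<lambda>n. \<integral>\<^sup>+\<omega>. ennreal (norm (Y n \<omega> - Z \<omega>) ^ p) \<partial>M) \<longlonglongrightarrow> 0"
  shows "(\<lambda>n. \<integral>\<^sup>+\<omega>. ennreal ((f (Y n \<omega>) - f (Z \<omega>))\<^sup>2) \<partial>M) \<longlonglongrightarrow> 0"
proof (rule tendsto_subsequenceI)
  fix r :: "nat \<Rightarrow> nat" assume r: "strict_mono r"
  have [measurable]: "f \<in> borel_measurable borel"
    using cont by (rule borel_measurable_continuous_onI)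
  define d where "d n \<omega> = norm (Y n \<omega> - Z \<omega>) ^ p" for n \<omega>
  define h where "h n \<omega> = (f (Y n \<omega>) - f (Z \<omega>))\<^sup>2" for n \<omega>
  define K where "K = 2 * A * (2 + 2 ^ p)"
  have [measurable]: "d n \<in> borel_measurable M" "h n \<in> borel_measurable M" for n
    unfolding d_def h_def by measurable
  have K: "0 \<le> K" using A by (simp add: K_def)
  have d0: "0 \<le> d n \<omega>" for n \<omega> by (simp add: d_def)
  have h_le: "h n \<omega> \<le> K * (1 + norm (Z \<omega>) ^ p) + K * d n \<omega>" for n \<omega>
  proof -
    have "norm (Y n \<omega>) ^ p \<le> (norm (Z \<omega>) + norm (Y n \<omega> - Z \<omega>)) ^ p"
      by (intro power_mono norm_ge_zero) (metis add_diff_cancel_left' diff_add_cancel norm_triangle_ineq add.commute)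
    also have "\<dots> \<le> 2 ^ p * (norm (Z \<omega>) ^ p + d n \<omega>)"
      unfolding d_def by (intro power_add_le) auto
    finally have Y_le: "norm (Y n \<omega>) ^ p \<le> 2 ^ p * (norm (Z \<omega>) ^ p + d n \<omega>)" .
    have "h n \<omega> \<le> 2 * (f (Y n \<omega>))\<^sup>2 + 2 * (f (Z \<omega>))\<^sup>2"
      using zero_le_power2[of "f (Y n \<omega>) + f (Z \<omega>)"]
      by (simp add: h_def power2_sum power2_diff)
    also have "\<dots> \<le> 2 * (A * (1 + norm (Y n \<omega>) ^ p)) + 2 * (A * (1 + norm (Z \<omega>) ^ p))"
      using growth by (intro add_mono mult_left_mono) auto
    also have "\<dots> = 2 * A * (2 + norm (Y n \<omega>) ^ p + norm (Z \<omega>) ^ p)"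
      by (simp add: algebra_simps)
    also have "\<dots> \<le> 2 * A * ((2 + 2 ^ p) * (1 + norm (Z \<omega>) ^ p + d n \<omega>))"
    proof (rule mult_left_mono)
      have "0 \<le> 2 ^ p * (1::real) + norm (Z \<omega>) ^ p + 2 * d n \<omega>" 
        using d0[of n \<omega>] by simp
      then show "2 + norm (Y n \<omega>) ^ p + norm (Z \<omega>) ^ p \<le> (2 + 2 ^ p) * (1 + norm (Z \<omega>) ^ p + d n \<omega>)"
        using Y_le by (simp add: algebra_simps)
    qed (use A in simp)
    finally show ?thesis by (simp add: K_def algebra_simps)
  qed
  have dr: "(\<lambda>i. \<integral>\<^sup>+\<omega>. ennreal (d (r i) \<omega>) \<partial>M) \<longlonglongrightarrow> 0"
    using LIMSEQ_subseq_LIMSEQ[OF conv r] by (simp add: d_def comp_def)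
  then have "\<forall>\<^sub>F i in sequentially. (\<integral>\<^sup>+\<omega>. ennreal (d (r i) \<omega>) \<partial>M) < 1"
    by (rule order_tendstoD) simp
  then obtain N where N: "\<And>i. i \<ge> N \<Longrightarrow> (\<integral>\<^sup>+\<omega>. ennreal (d (r i) \<omega>) \<partial>M) < 1"
    by (auto simp: eventually_sequentially)
  define u where "u i = d (r (i + N))" for i
  have int_u: "integrable M (u i)" for i
    unfolding u_def using N[of "i + N"] d0
    by (intro integrableI_nonneg) (auto intro: less_trans)
  have "(\<lambda>i. ennreal (\<integral>\<omega>. u i \<omega> \<partial>M)) \<longlonglongrightarrow> 0"
    using LIMSEQ_ignore_initial_segment[OF dr, of N] int_u d0
    by (simp add: u_def nn_integral_eq_integral)
  then have "(\<lambda>i. \<integral>\<omega>. norm (u i \<omega>) \<partial>M) \<longlonglongrightarrow> 0"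
    using d0 by (simp add: u_def ennreal_tendsto_0_iff)
  \<comment> \<open>The shift by \<open>N\<close> discards the indices at which \<open>d\<close> might not be integrable.\<close>
  from tendsto_L1_AE_subseq[OF int_u this] obtain s where s: "strict_mono s"
    and ae: "AE \<omega> in M. (\<lambda>i. u (s i) \<omega>) \<longlonglongrightarrow> 0" by auto
  let ?t = "\<lambda>i. r (s i + N)"
  have t: "strict_mono ?t"
    using r s by (auto simp: strict_mono_def)
  have h_ae: "AE \<omega> in M. (\<lambda>i. h (?t i) \<omega>) \<longlonglongrightarrow> 0"
    using ae
  proof eventually_elim
    case (elim \<omega>)
    from tendsto_real_root[OF elim, of p] p
    have "(\<lambda>i. norm (Y (?t i) \<omega> - Z \<omega>)) \<longlonglongrightarrow> 0"
      by (simp add: u_def d_def real_root_power_cancel)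
    then have "(\<lambda>i. Y (?t i) \<omega>) \<longlonglongrightarrow> Z \<omega>"
      using LIM_zero_cancel tendsto_norm_zero_iff by blast
    then have "(\<lambda>i. f (Y (?t i) \<omega>)) \<longlonglongrightarrow> f (Z \<omega>)"
      using cont by (auto simp: continuous_on_eq_continuous_at intro: isCont_tendsto_compose)
    then show ?case
      unfolding h_def by (auto intro!: tendsto_eq_intros)
  qed
  let ?v = "\<lambda>i \<omega>. ennreal (h (?t i) \<omega> - K * d (?t i) \<omega>)"
  have "(\<lambda>i. \<integral>\<^sup>+\<omega>. ?v i \<omega> \<partial>M) \<longlonglongrightarrow> (\<integral>\<^sup>+\<omega>. ennreal 0 \<partial>M)"
  proof (rule nn_integral_dominated_convergence)
    show "AE \<omega> in M. ?v i \<omega> \<le> ennreal (K * (1 + norm (Z \<omega>) ^ p))" for i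
      using h_le[of "?t i"] by (auto intro!: ennreal_leI simp: algebra_simps)
    have "(\<integral>\<^sup>+\<omega>. ennreal (K * (1 + norm (Z \<omega>) ^ p)) \<partial>M)
        = ennreal K * (1 + (\<integral>\<^sup>+\<omega>. ennreal (norm (Z \<omega>) ^ p) \<partial>M))"
      using K by (simp add: ennreal_mult nn_integral_cmult nn_integral_add emeasure_space_1)
    also have "\<dots> < \<infinity>"
      using fin by (simp add: ennreal_mult_less_top)
    finally show "(\<integral>\<^sup>+\<omega>. ennreal (K * (1 + norm (Z \<omega>) ^ p)) \<partial>M) < \<infinity>" .
    show "AE \<omega> in M. (\<lambda>i. ?v i \<omega>) \<longlonglongrightarrow> ennreal 0"
      using h_ae ae
    proof eventually_elim
      case (elim \<omega>)
      then have "(\<lambda>i. h (?t i) \<omega> - K * d (?t i) \<omega>) \<longlonglongrightarrow> 0 - K * 0"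
        by (intro tendsto_intros) (auto simp: u_def)
      then show ?case by (intro tendsto_ennrealI) simp
    qed
  qed measurable
  moreover have "(\<lambda>i. ennreal K * (\<integral>\<^sup>+\<omega>. ennreal (d (?t i) \<omega>) \<partial>M)) \<longlonglongrightarrow> ennreal K * 0"
    using LIMSEQ_subseq_LIMSEQ[OF conv t]
    by (intro ennreal_tendsto_cmult) (simp_all add: d_def comp_def)
  ultimately have lim: "(\<lambda>i. (\<integral>\<^sup>+\<omega>. ?v i \<omega> \<partial>M) + ennreal K * (\<integral>\<^sup>+\<omega>. ennreal (d (?t i) \<omega>) \<partial>M)) \<longlonglongrightarrow> 0"
    using tendsto_add by fastforce
  have "(\<lambda>i. \<integral>\<^sup>+\<omega>. ennreal (h (?t i) \<omega>) \<partial>M) \<longlonglongrightarrow> 0"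
  proof (rule tendsto_sandwich[OF _ _ tendsto_const lim])
    have "(\<integral>\<^sup>+\<omega>. ennreal (h n \<omega>) \<partial>M)
        \<le> (\<integral>\<^sup>+\<omega>. ennreal (h n \<omega> - K * d n \<omega>) \<partial>M) + ennreal K * (\<integral>\<^sup>+\<omega>. ennreal (d n \<omega>) \<partial>M)" for n
    proof -
      have "ennreal (h n \<omega>) \<le> ennreal (h n \<omega> - K * d n \<omega>) + ennreal K * ennreal (d n \<omega>)" for \<omega>
      proof -
        have "ennreal (h n \<omega>) \<le> ennreal (max 0 (h n \<omega> - K * d n \<omega>) + K * d n \<omega>)"
          by (intro ennreal_leI) auto
        also have "\<dots> = ennreal (h n \<omega> - K * d n \<omega>) + ennreal K * ennreal (d n \<omega>)"
          using K d0[of n \<omega>] by (simp add: ennreal_mult max_def ennreal_neg)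
        finally show ?thesis .
      qed
      then have "(\<integral>\<^sup>+\<omega>. ennreal (h n \<omega>) \<partial>M)
          \<le> (\<integral>\<^sup>+\<omega>. ennreal (h n \<omega> - K * d n \<omega>) + ennreal K * ennreal (d n \<omega>) \<partial>M)"
        by (intro nn_integral_mono) auto
      then show ?thesis by (simp add: nn_integral_add nn_integral_cmult)
    qed
    then show "\<forall>\<^sub>F i in sequentially. (\<integral>\<^sup>+\<omega>. ennreal (h (?t i) \<omega>) \<partial>M)
        \<le> (\<integral>\<^sup>+\<omega>. ?v i \<omega> \<partial>M) + ennreal K * (\<integral>\<^sup>+\<omega>. ennreal (d (?t i) \<omega>) \<partial>M)"
      by simp
  qed simp
  then show "\<exists>s. strict_mono s \<and>
      (\<lambda>i. \<integral>\<^sup>+\<omega>. ennreal ((f (Y (r (s i)) \<omega>) - f (Z \<omega>))\<^sup>2) \<partial>M) \<longlonglongrightarrow> 0"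
    using s by (intro exI[of _ "\<lambda>i. s i + N"]) (simp add: h_def strict_mono_def)
qed

text \<open>With \<open>D = g n - G\<close>, the first two moments of \<open>g n = G + D\<close> differ from those of \<open>G\<close> only by
  \<open>E D\<close>, \<open>2 E (G D)\<close> and \<open>E D\<^sup>2\<close>, all controlled by \<open>E D\<^sup>2\<close> through the Cauchy-Schwarz inequality. Finitely
  many \<open>g n\<close> may fail to be integrable.\<close>

lemma (in prob_space) L2_tendsto_moments:
  fixes g :: "nat \<Rightarrow> 'a \<Rightarrow> real" and G :: "'a \<Rightarrow> real"
  assumes g [measurable]: "\<And>n. g n \<in> borel_measurable M" and G [measurable]: "G \<in> borel_measurable M"
    and fin: "(\<integral>\<^sup>+\<omega>. ennreal ((G \<omega>)\<^sup>2) \<partial>M) < \<infinity>"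
    and conv: "(\<lambda>n. \<integral>\<^sup>+\<omega>. ennreal ((g n \<omega> - G \<omega>)\<^sup>2) \<partial>M) \<longlonglongrightarrow> 0"
  shows "\<forall>\<^sub>F n in sequentially. integrable M (g n)"
    and "(\<lambda>n. variance (g n)) \<longlonglongrightarrow> variance G"
proof -
  define D where "D n \<omega> = g n \<omega> - G \<omega>" for n \<omega>
  have [measurable]: "D n \<in> borel_measurable M" for n
    unfolding D_def by measurable
  have G2: "integrable M (\<lambda>\<omega>. (G \<omega>)\<^sup>2)"
    using fin by (intro integrableI_nonneg) auto
  then have G1: "integrable M G"
    by (rule square_integrable_imp_integrable[rotated]) simp
  have D2: "\<forall>\<^sub>F n in sequentially. integrable M (\<lambda>\<omega>. (D n \<omega>)\<^sup>2)"
    using order_tendstoD(2)[OF conv, of 1, simplified]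
  proof eventually_elim
    case (elim n)
    then show ?case
      unfolding D_def by (intro integrableI_nonneg) (auto intro: less_trans)
  qed
  have D1: "integrable M (D n)" if "integrable M (\<lambda>\<omega>. (D n \<omega>)\<^sup>2)" for n
    using that by (rule square_integrable_imp_integrable[rotated]) simp
  have GD: "integrable M (\<lambda>\<omega>. G \<omega> * D n \<omega>)" if "integrable M (\<lambda>\<omega>. (D n \<omega>)\<^sup>2)" for n
  proof (rule Bochner_Integration.integrable_bound)
    show "integrable M (\<lambda>\<omega>. (G \<omega>)\<^sup>2 + (D n \<omega>)\<^sup>2)" using G2 that by simp
    have "\<bar>a * c\<bar> \<le> \<bar>a\<^sup>2 + c\<^sup>2\<bar>" for a c :: real
    proof -
      have "0 \<le> \<bar>a\<bar> * \<bar>c\<bar>" by simp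
      moreover have "2 * (\<bar>a\<bar> * \<bar>c\<bar>) \<le> a\<^sup>2 + c\<^sup>2"
        using sum_squares_bound[of "\<bar>a\<bar>" "\<bar>c\<bar>"] by simp
      ultimately have "\<bar>a\<bar> * \<bar>c\<bar> \<le> a\<^sup>2 + c\<^sup>2" by linarith
      then show ?thesis by (simp add: abs_mult)
    qed
    then show "AE \<omega> in M. norm (G \<omega> * D n \<omega>) \<le> norm ((G \<omega>)\<^sup>2 + (D n \<omega>)\<^sup>2)" by simp
  qed measurable
  let ?e = "\<lambda>n. expectation (\<lambda>\<omega>. (D n \<omega>)\<^sup>2)"
  have "\<forall>\<^sub>F n in sequentially. (\<integral>\<^sup>+\<omega>. ennreal ((g n \<omega> - G \<omega>)\<^sup>2) \<partial>M) = ennreal (?e n)"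
    using D2 unfolding D_def by eventually_elim (rule nn_integral_eq_integral, auto)
  from Lim_transform_eventually[OF conv this]
  have e: "?e \<longlonglongrightarrow> 0"
    by (simp add: ennreal_tendsto_0_iff)
  have g_eq: "g n = (\<lambda>\<omega>. G \<omega> + D n \<omega>)" for n by (simp add: D_def)
  show "\<forall>\<^sub>F n in sequentially. integrable M (g n)"
    using D2 by eventually_elim (unfold g_eq, use G1 D1 in auto)
  have small: "(\<lambda>n. sqrt (K * ?e n)) \<longlonglongrightarrow> 0" for K
    using tendsto_real_sqrt[OF tendsto_mult_right_zero[OF e, of K]] by simp
  have ED: "(\<lambda>n. expectation (D n)) \<longlonglongrightarrow> 0"
  proof (rule tendsto_rabs_zero_cancel, rule tendsto_sandwich[OF _ _ tendsto_const small[of 1]])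
    show "\<forall>\<^sub>F n in sequentially. \<bar>expectation (D n)\<bar> \<le> sqrt (1 * ?e n)"
      using D2
    proof eventually_elim
      case (elim n)
      have "(expectation (D n))\<^sup>2 \<le> ?e n"
        using variance_positive[of "D n"] variance_eq[OF D1[OF elim] elim] by simp
      then show ?case by (simp add: real_le_rsqrt)
    qed
  qed simp
  have EGD: "(\<lambda>n. expectation (\<lambda>\<omega>. G \<omega> * D n \<omega>)) \<longlonglongrightarrow> 0"
  proof (rule tendsto_rabs_zero_cancel,
      rule tendsto_sandwich[OF _ _ tendsto_const small[of "expectation (\<lambda>\<omega>. (G \<omega>)\<^sup>2)"]])
    show "\<forall>\<^sub>F n in sequentially. \<bar>expectation (\<lambda>\<omega>. G \<omega> * D n \<omega>)\<bar>
        \<le> sqrt (expectation (\<lambda>\<omega>. (G \<omega>)\<^sup>2) * ?e n)"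
      using D2
    proof eventually_elim
      case (elim n)
      let ?c = "expectation (\<lambda>\<omega>. \<bar>G \<omega>\<bar> * \<bar>D n \<omega>\<bar>)"
      have int: "integrable M (\<lambda>\<omega>. \<bar>G \<omega>\<bar> * \<bar>D n \<omega>\<bar>)"
        using integrable_abs[OF GD[OF elim]] by (simp add: abs_mult)
      have "ennreal (?c\<^sup>2) = (\<integral>\<^sup>+\<omega>. ennreal \<bar>G \<omega>\<bar> * ennreal \<bar>D n \<omega>\<bar> \<partial>M)\<^sup>2"
        using int by (simp add: nn_integral_eq_integral ennreal_power flip: ennreal_mult)
      also have "\<dots> \<le> (\<integral>\<^sup>+\<omega>. (ennreal \<bar>G \<omega>\<bar>)\<^sup>2 \<partial>M) * (\<integral>\<^sup>+\<omega>. (ennreal \<bar>D n \<omega>\<bar>)\<^sup>2 \<partial>M)"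
        by (rule Cauchy_Schwarz_nn_integral) measurable
      also have "\<dots> = ennreal (expectation (\<lambda>\<omega>. (G \<omega>)\<^sup>2) * ?e n)"
        using G2 elim by (simp add: ennreal_power nn_integral_eq_integral ennreal_mult)
      finally have "?c\<^sup>2 \<le> expectation (\<lambda>\<omega>. (G \<omega>)\<^sup>2) * ?e n"
        by (subst (asm) ennreal_le_iff) auto
      moreover have "\<bar>expectation (\<lambda>\<omega>. G \<omega> * D n \<omega>)\<bar> \<le> ?c"
        using integral_abs_bound[of M "\<lambda>\<omega>. G \<omega> * D n \<omega>"] by (simp add: abs_mult)
      ultimately show ?case using order_trans[OF _ real_le_rsqrt] by blast
    qed
  qed simp
  have "(\<lambda>n. expectation (\<lambda>\<omega>. (G \<omega>)\<^sup>2) + 2 * expectation (\<lambda>\<omega>. G \<omega> * D n \<omega>) + ?e n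
      - (expectation G + expectation (D n))\<^sup>2)
      \<longlonglongrightarrow> expectation (\<lambda>\<omega>. (G \<omega>)\<^sup>2) + 2 * 0 + 0 - (expectation G + 0)\<^sup>2"
    by (intro tendsto_intros EGD ED e)
  moreover have "variance G = expectation (\<lambda>\<omega>. (G \<omega>)\<^sup>2) + 2 * 0 + 0 - (expectation G + 0)\<^sup>2"
    using variance_eq[OF G1 G2] by simp
  moreover have "\<forall>\<^sub>F n in sequentially. expectation (\<lambda>\<omega>. (G \<omega>)\<^sup>2)
      + 2 * expectation (\<lambda>\<omega>. G \<omega> * D n \<omega>) + ?e n - (expectation G + expectation (D n))\<^sup>2 = variance (g n)"
    using D2
  proof eventually_elim
    case (elim n)
    have sq: "(\<lambda>\<omega>. (g n \<omega>)\<^sup>2) = (\<lambda>\<omega>. (G \<omega>)\<^sup>2 + 2 * (G \<omega> * D n \<omega>) + (D n \<omega>)\<^sup>2)"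
      by (simp add: g_eq power2_sum algebra_simps)
    have int: "integrable M (g n)" "integrable M (\<lambda>\<omega>. (g n \<omega>)\<^sup>2)"
      unfolding sq unfolding g_eq using G1 G2 GD[OF elim] D1[OF elim] elim by auto
    have "expectation (\<lambda>\<omega>. (g n \<omega>)\<^sup>2)
        = expectation (\<lambda>\<omega>. (G \<omega>)\<^sup>2) + 2 * expectation (\<lambda>\<omega>. G \<omega> * D n \<omega>) + ?e n"
      unfolding sq using G2 GD[OF elim] elim by simp
    moreover have "expectation (g n) = expectation G + expectation (D n)"
      unfolding g_eq using G1 D1[OF elim] by simp
    ultimately show ?case using variance_eq[OF int] by simp
  qed
  ultimately show "(\<lambda>n. variance (g n)) \<longlonglongrightarrow> variance G"
    by (simp only: Lim_transform_eventually)
qed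

text \<open>The weights adding up to one, the error of the weighted sum is the weighted sum of the errors.\<close>

lemma (in prob_space) L2_tendsto_weighted_sum:
  fixes g :: "'i \<Rightarrow> nat \<Rightarrow> 'a \<Rightarrow> real" and w :: "'i \<Rightarrow> real"
  assumes [measurable]: "\<And>i n. i \<in> I \<Longrightarrow> g i n \<in> borel_measurable M" "G \<in> borel_measurable M"
    and w: "(\<Sum>i\<in>I. w i) = 1"
    and conv: "\<And>i. i \<in> I \<Longrightarrow> (\<lambda>n. \<integral>\<^sup>+\<omega>. ennreal ((g i n \<omega> - G \<omega>)\<^sup>2) \<partial>M) \<longlonglongrightarrow> 0"
  shows "(\<lambda>n. \<integral>\<^sup>+\<omega>. ennreal (((\<Sum>i\<in>I. w i * g i n \<omega>) - G \<omega>)\<^sup>2) \<partial>M) \<longlonglongrightarrow> 0"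
proof -
  let ?K = "\<Sum>i\<in>I. (w i)\<^sup>2"
  have K: "0 \<le> ?K" by (simp add: sum_nonneg)
  have "(\<lambda>n. ennreal ?K * (\<Sum>i\<in>I. \<integral>\<^sup>+\<omega>. ennreal ((g i n \<omega> - G \<omega>)\<^sup>2) \<partial>M)) \<longlonglongrightarrow> ennreal ?K * (\<Sum>i\<in>I. 0)"
    by (intro ennreal_tendsto_cmult tendsto_sum conv) simp_all
  then have lim: "(\<lambda>n. ennreal ?K * (\<Sum>i\<in>I. \<integral>\<^sup>+\<omega>. ennreal ((g i n \<omega> - G \<omega>)\<^sup>2) \<partial>M)) \<longlonglongrightarrow> 0"
    by simp
  show ?thesis
  proof (rule tendsto_sandwich[OF _ _ tendsto_const lim])
    have "(\<integral>\<^sup>+\<omega>. ennreal (((\<Sum>i\<in>I. w i * g i n \<omega>) - G \<omega>)\<^sup>2) \<partial>M)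
        \<le> ennreal ?K * (\<Sum>i\<in>I. \<integral>\<^sup>+\<omega>. ennreal ((g i n \<omega> - G \<omega>)\<^sup>2) \<partial>M)" for n
    proof -
      have "ennreal (((\<Sum>i\<in>I. w i * g i n \<omega>) - G \<omega>)\<^sup>2)
          \<le> ennreal ?K * (\<Sum>i\<in>I. ennreal ((g i n \<omega> - G \<omega>)\<^sup>2))" for \<omega>
      proof -
        have "(\<Sum>i\<in>I. w i * g i n \<omega>) - G \<omega> = (\<Sum>i\<in>I. w i * (g i n \<omega> - G \<omega>))"
          using w by (simp add: right_diff_distrib sum_subtractf flip: sum_distrib_right)
        then show ?thesis
          using Cauchy_Schwarz_ineq_sum[of w "\<lambda>i. g i n \<omega> - G \<omega>" I] K
          by (simp add: sum_nonneg flip: ennreal_mult)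
      qed
      then have "(\<integral>\<^sup>+\<omega>. ennreal (((\<Sum>i\<in>I. w i * g i n \<omega>) - G \<omega>)\<^sup>2) \<partial>M)
          \<le> (\<integral>\<^sup>+\<omega>. ennreal ?K * (\<Sum>i\<in>I. ennreal ((g i n \<omega> - G \<omega>)\<^sup>2)) \<partial>M)"
        by (intro nn_integral_mono) auto
      also have "\<dots> = ennreal ?K * (\<Sum>i\<in>I. \<integral>\<^sup>+\<omega>. ennreal ((g i n \<omega> - G \<omega>)\<^sup>2) \<partial>M)"
        by (subst nn_integral_cmult) (auto simp: nn_integral_sum simp del: sum_ennreal)
      finally show ?thesis .
    qed
    then show "\<forall>\<^sub>F n in sequentially. (\<integral>\<^sup>+\<omega>. ennreal (((\<Sum>i\<in>I. w i * g i n \<omega>) - G \<omega>)\<^sup>2) \<partial>M)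
        \<le> ennreal ?K * (\<Sum>i\<in>I. \<integral>\<^sup>+\<omega>. ennreal ((g i n \<omega> - G \<omega>)\<^sup>2) \<partial>M)"
      by simp
  qed simp
qed

section \<open>Measurability of the solution and of the Euler scheme\<close>

lemma borel_measurable_matrix_vector_mult [measurable (raw)]:
  fixes A :: "'a \<Rightarrow> real^'q^'d" and v :: "'a \<Rightarrow> real^'q"
  assumes "A \<in> borel_measurable N" "v \<in> borel_measurable N"
  shows "(\<lambda>\<omega>. A \<omega> *v v \<omega>) \<in> borel_measurable N"
proof -
  have "continuous_on UNIV (\<lambda>z :: (real^'q^'d) \<times> (real^'q). fst z *v snd z)"
    unfolding matrix_vector_mult_def by (intro continuous_intros)
  from borel_measurable_continuous_Pair[OF assms this] show ?thesis by simp
qed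

lemma brownian_setup_measurable:
  assumes "brownian_setup T M F W" "t \<in> {0..T}"
  shows "W t \<in> borel_measurable M"
  using assms measurable_from_subalg[of M "F t" "W t" borel]
  by (auto simp: brownian_setup_def brownian_motion_on_def filtration_on_def)

lemma strong_solution_measurable:
  assumes bm: "brownian_setup T M F W" and sol: "strong_solution T x b \<sigma> M W X" and t: "t \<in> {0..T}"
  shows "X t \<in> borel_measurable M"
proof -
  let ?G = "{W s -` A \<inter> space M | s A. s \<in> {0..t} \<and> A \<in> sets borel} \<union> null_sets M"
  have "?G \<subseteq> sets M"
    using brownian_setup_measurable[OF bm] t by (auto intro: measurable_sets)
  then have "subalgebra M (augmented_filtration M W t)"
    using sets.space_closed[of M] sets.sigma_sets_subset[of ?G M]
    by (auto simp: subalgebra_def augmented_filtration_def space_measure_of_conv sets_measure_of_conv)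
  then show ?thesis
    using sol t by (auto simp: strong_solution_def intro: measurable_from_subalg)
qed

lemma brownian_euler_measurable:
  assumes T: "T > 0"
    and b: "continuous_on ({0..T} \<times> UNIV) (\<lambda>(t, y). b t y)"
    and \<sigma>: "continuous_on ({0..T} \<times> UNIV) (\<lambda>(t, y). \<sigma> t y)"
    and bm: "brownian_setup T M F W" and t: "t \<in> {0..T}"
  shows "brownian_euler T x b \<sigma> W m t \<in> borel_measurable M"
proof -
  have grid: "real k * T / real m \<in> {0..T}" if "k \<le> m" for k
  proof -
    have "real k * T \<le> real m * T" using that T by simp
    then show ?thesis using T by (cases "m = 0") (auto simp: field_simps)
  qed
  have sect: "g s \<in> borel_measurable borel"
    if "continuous_on ({0..T} \<times> UNIV) (\<lambda>(t, y). g t y)" "s \<in> {0..T}"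
    for g :: "real \<Rightarrow> real^'d \<Rightarrow> 'e::topological_space" and s
  proof (rule borel_measurable_continuous_onI)
    have "continuous_on UNIV ((\<lambda>(t, y). g t y) \<circ> Pair s)"
      using that by (intro continuous_on_compose continuous_intros) (auto elim: continuous_on_subset)
    then show "continuous_on UNIV (g s)" by (simp add: comp_def)
  qed
  have euler_m: "(\<lambda>\<omega>. euler T x b \<sigma> m (brownian_noise T m W \<omega>) k) \<in> borel_measurable M" if "k \<le> m" for k
    using that
  proof (induction k)
    case (Suc k)
    then have [measurable]: "(\<lambda>\<omega>. euler T x b \<sigma> m (brownian_noise T m W \<omega>) k) \<in> borel_measurable M"
      by simp
    have [measurable]: "b (real k * T / real m) \<in> borel_measurable borel"
      "\<sigma> (real k * T / real m) \<in> borel_measurable borel"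
      using sect[OF b grid] sect[OF \<sigma> grid] Suc.prems by simp_all
    have [measurable]: "W (real (Suc k) * T / real m) \<in> borel_measurable M"
      "W (real k * T / real m) \<in> borel_measurable M"
      using grid[of k] grid[of "Suc k"] Suc.prems brownian_setup_measurable[OF bm] by simp_all
    have "real (Suc k) - 1 = real k" by simp
    then have [measurable]: "(\<lambda>\<omega>. brownian_noise T m W \<omega> (Suc k)) \<in> borel_measurable M"
      unfolding brownian_noise_def by (simp only:) measurable
    show ?case
      unfolding euler.simps by measurable
  qed simp
  have "t * real m / T \<le> real m"
    using t T mult_right_mono[of t T "real m"] by (simp add: divide_le_eq mult.commute)
  then have "nat \<lfloor>t * real m / T\<rfloor> \<le> m" by linarith
  from euler_m[OF this] show ?thesis
    by (simp add: brownian_euler_def[abs_def] euler_path_def)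
qed

section \<open>Moments of the solution\<close>

lemma brownian_euler_step:
  assumes "T > 0" "real k * T / real m \<le> s" "s < real (Suc k) * T / real m"
  shows "brownian_euler T x b \<sigma> W m s = brownian_euler T x b \<sigma> W m (real k * T / real m)"
proof -
  have "m \<noteq> 0" using assms by (intro notI) simp
  then have "\<lfloor>s * real m / T\<rfloor> = int k"
    using assms by (intro floor_unique) (simp_all add: field_simps)
  moreover have "\<lfloor>real k * T / real m * real m / T\<rfloor> = int k"
    using \<open>m \<noteq> 0\<close> assms(1) by simp
  ultimately show ?thesis
    by (intro ext) (simp add: brownian_euler_def euler_path_def)
qed

lemma nn_integral_power_norm_transfer:
  fixes u v :: "'a \<Rightarrow> 'b::euclidean_space"
  assumes [measurable]: "u \<in> borel_measurable M" "v \<in> borel_measurable M"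
    and u: "(\<integral>\<^sup>+\<omega>. ennreal (norm (u \<omega>) ^ p) \<partial>M) < \<infinity>"
    and diff: "(\<integral>\<^sup>+\<omega>. ennreal (norm (u \<omega> - v \<omega>) ^ p) \<partial>M) < \<infinity>"
  shows "(\<integral>\<^sup>+\<omega>. ennreal (norm (v \<omega>) ^ p) \<partial>M) < \<infinity>"
proof -
  have "ennreal (norm (v \<omega>) ^ p)
      \<le> ennreal (2 ^ p) * (ennreal (norm (u \<omega>) ^ p) + ennreal (norm (u \<omega> - v \<omega>) ^ p))" for \<omega>
  proof -
    have "norm (v \<omega>) ^ p \<le> (norm (u \<omega>) + norm (u \<omega> - v \<omega>)) ^ p"
      using norm_triangle_ineq4[of "u \<omega>" "u \<omega> - v \<omega>"] by (intro power_mono) auto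
    also have "\<dots> \<le> 2 ^ p * (norm (u \<omega>) ^ p + norm (u \<omega> - v \<omega>) ^ p)"
      by (rule power_add_le) auto
    finally show ?thesis
      by (simp flip: ennreal_mult ennreal_plus)
  qed
  then have "(\<integral>\<^sup>+\<omega>. ennreal (norm (v \<omega>) ^ p) \<partial>M)
      \<le> (\<integral>\<^sup>+\<omega>. ennreal (2 ^ p) * (ennreal (norm (u \<omega>) ^ p) + ennreal (norm (u \<omega> - v \<omega>) ^ p)) \<partial>M)"
    by (intro nn_integral_mono) auto
  also have "\<dots> = ennreal (2 ^ p) * ((\<integral>\<^sup>+\<omega>. ennreal (norm (u \<omega>) ^ p) \<partial>M)
      + (\<integral>\<^sup>+\<omega>. ennreal (norm (u \<omega> - v \<omega>) ^ p) \<partial>M))"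
    by (subst nn_integral_cmult) (simp_all add: nn_integral_add del: ennreal_plus)
  also have "\<dots> < \<infinity>"
    using u diff by (simp add: ennreal_mult_less_top)
  finally show ?thesis .
qed

text \<open>As \<open>Y\<close> may jump at \<open>t\<close>, the bound at \<open>t\<close> is obtained as the left limit of those on \<open>[s, t)\<close>.\<close>

lemma norm_power_le_SUP_left_limit:
  fixes X :: "real \<Rightarrow> 'b::real_normed_vector"
  assumes cont: "continuous_on {0..T} X" and s: "0 \<le> s" "s < t" "t \<le> T"
    and const: "\<And>r. s \<le> r \<Longrightarrow> r < t \<Longrightarrow> Y r = c"
  shows "ennreal (norm (X t - c) ^ p) \<le> (SUP r\<in>{0..T}. ennreal (norm (X r - Y r) ^ p))" (is "_ \<le> ?S")
proof (cases "?S = \<top>")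
  case False
  then obtain a where a: "0 \<le> a" "?S = ennreal a" by (cases ?S) auto
  have "norm (X t - c) ^ p \<le> a"
  proof (rule continuous_le_on_closure[where S = "{s..<t}" and f = "\<lambda>r. norm (X r - c) ^ p"])
    have "closure {s..<t} \<subseteq> {0..T}" using s by simp
    then show "continuous_on (closure {s..<t}) (\<lambda>r. norm (X r - c) ^ p)"
      using cont by (intro continuous_intros) (rule continuous_on_subset)
    show "t \<in> closure {s..<t}" using s by simp
    fix r assume r: "r \<in> {s..<t}"
    then have "ennreal (norm (X r - Y r) ^ p) \<le> ?S"
      using s by (intro SUP_upper) auto
    then show "norm (X r - c) ^ p \<le> a"
      using a const[of r] r by (simp add: ennreal_le_iff)
  qed
  then show ?thesis using a by (simp add: ennreal_leI)
qed (simp only: top_greatest)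

text \<open>Moments are propagated from one grid point to the next, alternating between \<open>X\<close> and the scheme \<open>Y\<close>:
  \<open>X\<close> at \<open>s\<close>, then \<open>Y\<close> at \<open>s\<close>, then \<open>X\<close> at the next grid point \<open>t\<close>, the last step because \<open>Y\<close> keeps its
  value on \<open>[s, t)\<close>. Computing the moment of \<open>Y\<close> at \<open>t\<close> from the recursion instead would need
  growth bounds on the coefficients.\<close>

lemma strong_solution_moment:
  assumes T: "T > 0"
    and b: "continuous_on ({0..T} \<times> UNIV) (\<lambda>(t, y). b t y)"
    and \<sigma>: "continuous_on ({0..T} \<times> UNIV) (\<lambda>(t, y). \<sigma> t y)"
    and bm: "brownian_setup T M F W" and sol: "strong_solution T x b \<sigma> M W X"
    and p: "0 < p" and conv: "converges_in_Lp_sup T M (real p) (brownian_euler T x b \<sigma> W) X"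
  shows "(\<integral>\<^sup>+\<omega>. ennreal (norm (X T \<omega>) ^ p) \<partial>M) < \<infinity>"
    and "(\<lambda>n. \<integral>\<^sup>+\<omega>. ennreal (norm (brownian_euler T x b \<sigma> W n T \<omega> - X T \<omega>) ^ p) \<partial>M) \<longlonglongrightarrow> 0"
proof -
  interpret prob_space M using bm by (simp add: brownian_setup_def)
  let ?Y = "brownian_euler T x b \<sigma> W"
  let ?S = "\<lambda>n \<omega>. SUP t\<in>{0..T}. ennreal (norm (X t \<omega> - ?Y n t \<omega>) ^ p)"
  have S: "(\<lambda>n. \<integral>\<^sup>+\<omega>. ?S n \<omega> \<partial>M) \<longlonglongrightarrow> 0"
    using conv p by (simp add: converges_in_Lp_sup_def powr_realpow')
  note Xm = strong_solution_measurable[OF bm sol]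
  note Ym = brownian_euler_measurable[OF T b \<sigma> bm]
  have le_S: "(\<integral>\<^sup>+\<omega>. ennreal (norm (X t \<omega> - ?Y n t \<omega>) ^ p) \<partial>M) \<le> (\<integral>\<^sup>+\<omega>. ?S n \<omega> \<partial>M)"
    if "t \<in> {0..T}" for n t
    using that by (intro nn_integral_mono SUP_upper)
  have "\<forall>\<^sub>F n in sequentially. (\<integral>\<^sup>+\<omega>. ?S n \<omega> \<partial>M) < \<infinity>"
    using order_tendstoD(2)[OF S, of \<infinity>] by simp
  from eventually_happens'[OF _ eventually_conj[OF this eventually_gt_at_top[of 0]]]
  obtain n where n: "(\<integral>\<^sup>+\<omega>. ?S n \<omega> \<partial>M) < \<infinity>" "0 < n" by auto
  have grid: "real k * T / real n \<in> {0..T}" if "k \<le> n" for k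
    using that n T by (auto simp: field_simps)
  have "(\<integral>\<^sup>+\<omega>. ennreal (norm (X (real k * T / real n) \<omega>) ^ p) \<partial>M) < \<infinity>" if "k \<le> n" for k
    using that
  proof (induction k)
    case 0
    have "AE \<omega> in M. X 0 \<omega> = x" using sol by (simp add: strong_solution_def)
    then have "(\<integral>\<^sup>+\<omega>. ennreal (norm (X 0 \<omega>) ^ p) \<partial>M) = (\<integral>\<^sup>+\<omega>. ennreal (norm x ^ p) \<partial>M)"
      by (intro nn_integral_cong_AE) auto
    then show ?case by (simp add: emeasure_space_1)
  next
    case (Suc k)
    let ?s = "real k * T / real n" and ?t = "real (Suc k) * T / real n"
    have s: "?s \<in> {0..T}" and t: "?t \<in> {0..T}"
      using grid[of k] grid[of "Suc k"] Suc.prems by simp_all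
    have st: "?s < ?t" using n T by (intro divide_strict_right_mono mult_strict_right_mono) auto
    have "(\<integral>\<^sup>+\<omega>. ennreal (norm (X ?s \<omega> - ?Y n ?s \<omega>) ^ p) \<partial>M) < \<infinity>"
      using le_S[OF s, of n] n(1) by (rule le_less_trans)
    then have Y: "(\<integral>\<^sup>+\<omega>. ennreal (norm (?Y n ?s \<omega>) ^ p) \<partial>M) < \<infinity>"
      using Suc by (intro nn_integral_power_norm_transfer[OF Xm[OF s] Ym[OF s]]) auto
    have "(\<integral>\<^sup>+\<omega>. ennreal (norm (?Y n ?s \<omega> - X ?t \<omega>) ^ p) \<partial>M) \<le> (\<integral>\<^sup>+\<omega>. ?S n \<omega> \<partial>M)"
    proof (rule nn_integral_mono)
      fix \<omega> assume "\<omega> \<in> space M"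
      then have "continuous_on {0..T} (\<lambda>t. X t \<omega>)" using sol by (simp add: strong_solution_def)
      then show "ennreal (norm (?Y n ?s \<omega> - X ?t \<omega>) ^ p) \<le> ?S n \<omega>"
        unfolding norm_minus_commute[of "?Y n ?s \<omega>"]
        using s t st by (intro norm_power_le_SUP_left_limit[where s = ?s])
          (auto simp del: of_nat_Suc intro!: fun_cong[OF brownian_euler_step[OF T]])
    qed
    then have "(\<integral>\<^sup>+\<omega>. ennreal (norm (?Y n ?s \<omega> - X ?t \<omega>) ^ p) \<partial>M) < \<infinity>"
      using n by (auto intro: le_less_trans)
    with Y show ?case
      by (rule nn_integral_power_norm_transfer[OF Ym[OF s] Xm[OF t]])
  qed
  from this[of n] n show "(\<integral>\<^sup>+\<omega>. ennreal (norm (X T \<omega>) ^ p) \<partial>M) < \<infinity>" by simp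
  show "(\<lambda>n. \<integral>\<^sup>+\<omega>. ennreal (norm (?Y n T \<omega> - X T \<omega>) ^ p) \<partial>M) \<longlonglongrightarrow> 0"
    using le_S[of T] T norm_minus_commute[of "?Y _ T _"]
    by (intro tendsto_sandwich[OF _ _ tendsto_const S] always_eventually) (auto simp: norm_minus_commute)
qed

section \<open>The multistep estimator\<close>

text \<open>Replacing \<open>n\<close> by \<open>r * n\<close> turns the coefficient \<open>c k\<close> into \<open>c k / r ^ k\<close>; after weighting, the sums over \<open>r\<close>
  of these are exactly the vanishing moments of the weights.\<close>

lemma euler_expansion_refined:
  fixes a :: "nat \<Rightarrow> real" and c :: "nat \<Rightarrow> real"
  assumes exp: "(\<lambda>n. L - (a n + (\<Sum>k\<in>{1..<R}. c k / real n ^ k))) \<in> O(\<lambda>n. 1 / real n ^ R)"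
    and R: "1 \<le> R"
  shows "(\<lambda>n. (\<Sum>r = 1..R. richardson_weight R r * a (r * n)) - L) \<in> O(\<lambda>n. 1 / real n ^ R)"
proof -
  let ?e = "\<lambda>n. L - (a n + (\<Sum>k\<in>{1..<R}. c k / real n ^ k))"
  let ?w = "richardson_weight R"
  have w: "(\<Sum>r = 1..R. ?w r) = 1"
    using richardson_weight_moment[of 0 R] R by simp
  have cancel: "(\<Sum>r = 1..R. ?w r * (\<Sum>k\<in>{1..<R}. c k / real (r * n) ^ k)) = 0" for n
  proof -
    have "(\<Sum>r = 1..R. ?w r * (\<Sum>k\<in>{1..<R}. c k / real (r * n) ^ k))
        = (\<Sum>k\<in>{1..<R}. \<Sum>r = 1..R. ?w r * (c k / real (r * n) ^ k))"
      unfolding sum_distrib_left by (rule sum.swap)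
    also have "\<dots> = (\<Sum>k\<in>{1..<R}. c k / real n ^ k * (\<Sum>r = 1..R. ?w r / real r ^ k))"
      unfolding sum_distrib_left by (intro sum.cong refl) (simp add: power_mult_distrib mult_ac)
    also have "\<dots> = 0"
    proof (rule sum.neutral, rule ballI)
      fix k assume "k \<in> {1..<R}"
      then show "c k / real n ^ k * (\<Sum>r = 1..R. ?w r / real r ^ k) = 0"
        using richardson_weight_moment[of k R] by simp
    qed
    finally show ?thesis .
  qed
  have eq: "(\<Sum>r = 1..R. ?w r * a (r * n)) - L = (\<Sum>r = 1..R. - ?w r * ?e (r * n))" for n
  proof -
    have "(\<Sum>r = 1..R. - ?w r * ?e (r * n))
        = (\<Sum>r = 1..R. ?w r * a (r * n)) + (\<Sum>r = 1..R. ?w r * (\<Sum>k\<in>{1..<R}. c k / real (r * n) ^ k))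
          - (\<Sum>r = 1..R. ?w r) * L"
      unfolding sum_distrib_right sum.distrib[symmetric] sum_subtractf[symmetric]
      by (intro sum.cong refl) (simp add: algebra_simps)
    then show ?thesis unfolding w cancel by simp
  qed
  show ?thesis
    unfolding eq
  proof (rule big_sum_in_bigo)
    fix r assume "r \<in> {1..R}"
    then have r: "0 < r" by simp
    then have "filterlim (\<lambda>n. r * n) at_top sequentially"
      by (intro filterlim_subseq) (auto simp: strict_mono_def)
    from landau_o.big.compose[OF exp this]
    have "(\<lambda>n. ?e (r * n)) \<in> O(\<lambda>n. 1 / real (r * n) ^ R)" .
    also have "(\<lambda>n. 1 / real (r * n) ^ R) = (\<lambda>n. 1 / real r ^ R * (1 / real n ^ R))"
      by (simp add: power_mult_distrib)
    also have "O(\<lambda>n. 1 / real r ^ R * (1 / real n ^ R)) = O(\<lambda>n. 1 / real n ^ R)"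
      using r by (intro landau_o.big.cmult) simp
    finally show "(\<lambda>n. - ?w r * ?e (r * n)) \<in> O(\<lambda>n. 1 / real n ^ R)"
      by simp
  qed
qed

theorem mainTheorem3:
  fixes T :: real and x :: "real^'d" and R :: nat
    and b :: "real \<Rightarrow> real^'d \<Rightarrow> real^'d"
    and \<sigma> :: "real \<Rightarrow> real^'d \<Rightarrow> real^'q^'d"
    and X :: "'w measure \<Rightarrow> (real \<Rightarrow> 'w measure) \<Rightarrow> (real \<Rightarrow> 'w \<Rightarrow> real^'q) \<Rightarrow> real \<Rightarrow> 'w \<Rightarrow> real^'d"
    and V :: "(real^'d \<Rightarrow> real) set"
    and M :: "'w measure" and F :: "real \<Rightarrow> 'w measure" and W :: "real \<Rightarrow> 'w \<Rightarrow> real^'q"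
  assumes "T > 0"
    and "continuous_on ({0..T} \<times> UNIV) (\<lambda>(t, y). b t y)"
    and "continuous_on ({0..T} \<times> UNIV) (\<lambda>(t, y). \<sigma> t y)"
    and "\<And>M F W. brownian_setup T M F W \<Longrightarrow> strong_solution T x b \<sigma> M W (X M F W)"
    and "\<And>M F W p. brownian_setup T M F W \<Longrightarrow> p \<ge> 1 \<Longrightarrow>
           converges_in_Lp_sup T M p (brownian_euler T x b \<sigma> W) (X M F W)"
    and "R \<ge> 1"
    and "function_space V" and "product_stable V" and "characterizing V"
    and "\<And>f. f \<in> V \<Longrightarrow> continuous_on UNIV f"
    and "\<And>f. f \<in> V \<Longrightarrow> polynomial_growth f"
    and "brownian_setup T M F W"
    and "euler_expansion T x b \<sigma> M W (X M F W) R V"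
  shows "\<forall>f\<in>V.
     (\<lambda>n. prob_space.expectation M (multistep_estimator T x b \<sigma> W R f n)
        - prob_space.expectation M (\<lambda>\<omega>. f (X M F W T \<omega>))) \<in> O(\<lambda>n. 1 / real n ^ R) \<and>
     (\<lambda>n. prob_space.variance M (multistep_estimator T x b \<sigma> W R f n))
        \<longlonglongrightarrow> prob_space.variance M (\<lambda>\<omega>. f (X M F W T \<omega>))"
proof
  note T = assms(1) and R = assms(6) and bm = assms(12)
  fix f assume f: "f \<in> V"
  interpret prob_space M using bm by (simp add: brownian_setup_def)
  let ?X = "X M F W"
  let ?Y = "brownian_euler T x b \<sigma> W"
  have sol: "strong_solution T x b \<sigma> M W ?X" using assms(4)[OF bm] .
  have [measurable]: "?X T \<in> borel_measurable M"
    using strong_solution_measurable[OF bm sol] T by simp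
  have [measurable]: "?Y n T \<in> borel_measurable M" for n
    using brownian_euler_measurable[OF assms(1-3) bm] T by simp
  have [measurable]: "f \<in> borel_measurable borel"
    using assms(10)[OF f] by (rule borel_measurable_continuous_onI)
  obtain A p where p: "0 < p" and A: "0 \<le> A"
    and growth: "\<And>y. (f y)\<^sup>2 \<le> A * (1 + norm y ^ p)"
    by (rule polynomial_growth_square[OF assms(11)[OF f]]) (rule that)
  note moment = strong_solution_moment[OF assms(1-3) bm sol p assms(5)[OF bm]]
  have Xp: "(\<integral>\<^sup>+\<omega>. ennreal (norm (?X T \<omega>) ^ p) \<partial>M) < \<infinity>"
    and Yp: "(\<lambda>n. \<integral>\<^sup>+\<omega>. ennreal (norm (?Y n T \<omega> - ?X T \<omega>) ^ p) \<partial>M) \<longlonglongrightarrow> 0"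
    using moment p by simp_all
  have fX: "(\<integral>\<^sup>+\<omega>. ennreal ((f (?X T \<omega>))\<^sup>2) \<partial>M) < \<infinity>"
  proof -
    have "(\<integral>\<^sup>+\<omega>. ennreal ((f (?X T \<omega>))\<^sup>2) \<partial>M)
        \<le> (\<integral>\<^sup>+\<omega>. ennreal (A * (1 + norm (?X T \<omega>) ^ p)) \<partial>M)"
      using growth by (intro nn_integral_mono ennreal_leI) auto
    also have "\<dots> = ennreal A * (1 + (\<integral>\<^sup>+\<omega>. ennreal (norm (?X T \<omega>) ^ p) \<partial>M))"
      using A by (simp add: ennreal_mult nn_integral_cmult nn_integral_add emeasure_space_1)
    also have "\<dots> < \<infinity>" using Xp by (simp add: ennreal_mult_less_top)
    finally show ?thesis .
  qed
  have fY: "(\<lambda>n. \<integral>\<^sup>+\<omega>. ennreal ((f (?Y n T \<omega>) - f (?X T \<omega>))\<^sup>2) \<partial>M) \<longlonglongrightarrow> 0"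
    by (rule L2_tendsto_polynomial_growth[OF _ _ assms(10)[OF f] p A growth Xp Yp]) measurable
  have refine: "filterlim (\<lambda>n. r * n) at_top sequentially" if "r \<in> {1..R}" for r
    using that by (intro filterlim_subseq) (auto simp: strict_mono_def)
  \<comment> \<open>Linearity of the expectation is justified for large \<open>n\<close>, where all \<open>R\<close> schemes are integrable.\<close>
  have "\<forall>\<^sub>F n in sequentially. integrable M (\<lambda>\<omega>. f (?Y n T \<omega>))"
    by (rule L2_tendsto_moments(1)[OF _ _ fX fY]) measurable
  then have int: "\<forall>\<^sub>F n in sequentially. \<forall>r\<in>{1..R}. integrable M (\<lambda>\<omega>. f (?Y (r * n) T \<omega>))"
    by (intro eventually_ball_finite ballI eventually_compose_filterlim[OF _ refine]) simp_all
  from assms(13) f obtain c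
    where c: "(\<lambda>n. expectation (\<lambda>\<omega>. f (?X T \<omega>))
        - (expectation (\<lambda>\<omega>. f (?Y n T \<omega>)) + (\<Sum>k\<in>{1..<R}. c k / real n ^ k))) \<in> O(\<lambda>n. 1 / real n ^ R)"
    unfolding euler_expansion_def by blast
  have eq: "\<forall>\<^sub>F n in sequentially. expectation (multistep_estimator T x b \<sigma> W R f n)
      - expectation (\<lambda>\<omega>. f (?X T \<omega>))
      = (\<Sum>r = 1..R. richardson_weight R r * expectation (\<lambda>\<omega>. f (?Y (r * n) T \<omega>)))
      - expectation (\<lambda>\<omega>. f (?X T \<omega>))"
    using int by eventually_elim (simp add: multistep_estimator_def[abs_def])
  have bias: "(\<lambda>n. expectation (multistep_estimator T x b \<sigma> W R f n)
      - expectation (\<lambda>\<omega>. f (?X T \<omega>))) \<in> O(\<lambda>n. 1 / real n ^ R)"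
    unfolding landau_o.big.in_cong[OF eq] by (rule euler_expansion_refined[OF c R])
  have "(\<lambda>n. variance (multistep_estimator T x b \<sigma> W R f n)) \<longlonglongrightarrow> variance (\<lambda>\<omega>. f (?X T \<omega>))"
  proof (rule L2_tendsto_moments(2)[OF _ _ fX])
    show "multistep_estimator T x b \<sigma> W R f n \<in> borel_measurable M" for n
      unfolding multistep_estimator_def[abs_def] by measurable
    show "(\<lambda>n. \<integral>\<^sup>+\<omega>. ennreal ((multistep_estimator T x b \<sigma> W R f n \<omega> - f (?X T \<omega>))\<^sup>2) \<partial>M) \<longlonglongrightarrow> 0"
      unfolding multistep_estimator_def
    proof (rule L2_tendsto_weighted_sum)
      show "(\<Sum>r = 1..R. richardson_weight R r) = 1"
        using richardson_weight_moment[of 0 R] R by simp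
      show "(\<lambda>n. \<integral>\<^sup>+\<omega>. ennreal ((f (?Y (r * n) T \<omega>) - f (?X T \<omega>))\<^sup>2) \<partial>M) \<longlonglongrightarrow> 0"
        if "r \<in> {1..R}" for r
        using filterlim_compose[OF fY refine[OF that]] .
    qed measurable
  qed measurable
  with bias show "(\<lambda>n. expectation (multistep_estimator T x b \<sigma> W R f n)
      - expectation (\<lambda>\<omega>. f (?X T \<omega>))) \<in> O(\<lambda>n. 1 / real n ^ R) \<and>
    (\<lambda>n. variance (multistep_estimator T x b \<sigma> W R f n)) \<longlonglongrightarrow> variance (\<lambda>\<omega>. f (?X T \<omega>))" ..
qed

end
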